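(* Let $\{F_\theta:\theta\in\Theta\}$ be a standard exponential family generated by $F_0$, with $\Theta=[0,\theta_{\max})$, and for $\theta\in\Theta$ let $X_1,X_2,\dots$ be i.i.d. with law $F_\theta$ under $\mathbb{P}_\theta$. Let $C>0$, $r>0$, $\theta^\ast>0$ with $[0,\theta^\ast]\subset\Theta$ be constants such that for all $b>0$ and $y>0$ $$\sup_{\theta\in[0,\theta^\ast]}\bigl|\mathbb{P}_\theta(R_b\le y)-\mathbb{P}_\theta(R_\infty\le y)\bigr|\le C e^{-r(b+y)} .$$ Fix $\theta\in[0,\theta^\ast]$ and $b>0$, and put $F_{b,\theta}(y)=\mathbb{P}_\theta(R_b\le y)$, $F_{\infty,\theta}(y)=\mathbb{P}_\theta(R_\infty\le y)$ for $y\ge0$. Let $U$ be uniform on $(0,1)$, let $F^{-1}(u):=\inf\{t\ge0: F(t)\ge u\}$, and define $\widetilde R_b:=F_{b,\theta}^{-1}(U)$ and $\widetilde R_\infty:=F_{\infty,\theta}^{-1}(U)$. Then $\widetilde R_b\stackrel{d}{=}R_b$ and $\widetilde R_\infty\stackrel{d}{=}R_\infty$ (laws under $\mathbb{P}_\theta$), and $$\mathbb{E}_\theta\bigl|\widetilde R_b-\widetilde R_\infty\bigr| = W_1(R_b,R_\infty)\le\frac{C}{r}e^{-rb}.$$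
   Context: Standard exponential family: $F_0$ is a probability measure on $\mathbb{R}$ and $\Theta=[0,\theta_{\max})$, $\theta_{\max}\in(0,\infty]$, is such that $\int e^{\theta x}F_0(dx)<\infty$ for all $\theta\in\Theta$. Put $\psi(\theta)=\ln\int e^{\theta x}F_0(dx)$ and $F_\theta(dx)=e^{\theta x-\psi(\theta)}F_0(dx)$. The family $\{F_\theta\}$ is called standard if, for $X\sim F_0$, $\mathbb{E}[X]=0$ and $\mathrm{Var}(X)=1$, and $F_0$ is strongly non-lattice, i.e. $\limsup_{|t|\to\infty}\left|\int e^{itx}F_0(dx)\right|<1$. $\mathbb{P}_\theta,\mathbb{E}_\theta$ denote probability and expectation when $X_1,X_2,\dots$ are i.i.d. with law $F_\theta$. $S_0=0$, $S_n=X_1+\dots+X_n$. For $b\ge 0$: $\tau(b)=\inf\{n\ge1:S_n>b\}$ and the overshoot is $R_b=S_{\tau(b)}-b$. $R_\infty$ denotes a nonnegative random variable whose law under $\mathbb{P}_\theta$ is the weak limit of the law of $R_b$ under $\mathbb{P}_\theta$ as $b\to\infty$ (this limit is known to exist). It is a known result from the literature that constants $C,r,\theta^\ast$ with the assumed uniform estimate exist for every standard exponential family. For real random variables $X,Y$ with finite first moments, $W_1(X,Y)=\inf\{\mathbb{E}|X'-Y'|: X'\stackrel{d}{=}X,\ Y'\stackrel{d}{=}Y\}$, the infimum over all joint constructions (couplings) $(X',Y')$. Here $W_1(R_b,R_\infty)$ is taken for the laws under $\mathbb{P}_\theta$. *)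

theory Defs
  imports "HOL-Probability.Probability"
begin

definition param_space :: "ereal \<Rightarrow> real set" where
  "param_space \<theta>max = {\<theta>. 0 \<le> \<theta> \<and> ereal \<theta> < \<theta>max}"

definition log_mgf :: "real measure \<Rightarrow> real \<Rightarrow> real" where
  "log_mgf F0 \<theta> = ln (\<integral>x. exp (\<theta> * x) \<partial>F0)"

definition tilted :: "real measure \<Rightarrow> real \<Rightarrow> real measure" where
  "tilted F0 \<theta> = density F0 (\<lambda>x. ennreal (exp (\<theta> * x - log_mgf F0 \<theta>)))"

definition strongly_nonlattice :: "real measure \<Rightarrow> bool" where
  "strongly_nonlattice F0 \<longleftrightarrow> Limsup at_infinity (\<lambda>t::real. ereal (cmod (char F0 t))) < 1"

(* Integrability of the identity is stated separately because the Bochner integral of a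
   non-integrable function is 0. The variance clause forces square integrability. *)
definition standard_exp_family :: "real measure \<Rightarrow> ereal \<Rightarrow> bool" where
  "standard_exp_family F0 \<theta>max \<longleftrightarrow>
     real_distribution F0 \<and> 0 < \<theta>max \<and>
     (\<forall>\<theta>\<in>param_space \<theta>max. integrable F0 (\<lambda>x. exp (\<theta> * x))) \<and>
     integrable F0 (\<lambda>x. x) \<and>
     prob_space.expectation F0 (\<lambda>x. x) = 0 \<and>
     prob_space.variance F0 (\<lambda>x. x) = 1 \<and>
     strongly_nonlattice F0"

(* The sequence is indexed from 1; X 0 plays no role. *)
definition iid_with_law :: "'w measure \<Rightarrow> (nat \<Rightarrow> 'w \<Rightarrow> real) \<Rightarrow> real measure \<Rightarrow> bool" where
  "iid_with_law P X F \<longleftrightarrow>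
     prob_space P \<and> prob_space.indep_vars P (\<lambda>_. borel) X {1..} \<and>
     (\<forall>n\<ge>1. distr P borel (X n) = F)"

definition partial_sum :: "(nat \<Rightarrow> 'w \<Rightarrow> real) \<Rightarrow> nat \<Rightarrow> 'w \<Rightarrow> real" where
  "partial_sum X n \<omega> = (\<Sum>i = 1..n. X i \<omega>)"

definition passage_time :: "(nat \<Rightarrow> 'w \<Rightarrow> real) \<Rightarrow> real \<Rightarrow> 'w \<Rightarrow> nat" where
  "passage_time X b \<omega> = Inf {n. 1 \<le> n \<and> partial_sum X n \<omega> > b}"

(* The overshoot is set to 0 on the event that the walk never exceeds b. Under every member of
   a standard exponential family this event is null, since the increments have nonnegative mean
   and are nondegenerate. *)
definition overshoot :: "(nat \<Rightarrow> 'w \<Rightarrow> real) \<Rightarrow> real \<Rightarrow> 'w \<Rightarrow> real" where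
  "overshoot X b \<omega> =
     (if \<exists>n\<ge>1. partial_sum X n \<omega> > b
      then partial_sum X (passage_time X b \<omega>) \<omega> - b else 0)"

definition overshoot_law :: "'w measure \<Rightarrow> (nat \<Rightarrow> 'w \<Rightarrow> real) \<Rightarrow> real \<Rightarrow> real measure" where
  "overshoot_law P X b = distr P borel (overshoot X b)"

(* L is the law of the limiting overshoot. The library's weak convergence is for sequences, so
   the limit over real b is taken along every sequence of levels tending to infinity. *)
definition limit_overshoot_law :: "'w measure \<Rightarrow> (nat \<Rightarrow> 'w \<Rightarrow> real) \<Rightarrow> real measure \<Rightarrow> bool" where
  "limit_overshoot_law P X L \<longleftrightarrow>
     real_distribution L \<and> (AE x in L. 0 \<le> x) \<and>
     (\<forall>s::nat \<Rightarrow> real. filterlim s at_top sequentially \<longrightarrow>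
        weak_conv_m (\<lambda>n. overshoot_law P X (s n)) L)"

definition quantile :: "(real \<Rightarrow> real) \<Rightarrow> real \<Rightarrow> real" where
  "quantile F u = Inf {t. 0 \<le> t \<and> u \<le> F t}"

(* A joint construction (X', Y') enters only through its joint law on the plane. *)
definition couplings :: "real measure \<Rightarrow> real measure \<Rightarrow> (real \<times> real) measure set" where
  "couplings \<mu> \<nu> = {\<gamma>. prob_space \<gamma> \<and> sets \<gamma> = sets (borel \<Otimes>\<^sub>M borel) \<and>
     distr \<gamma> borel fst = \<mu> \<and> distr \<gamma> borel snd = \<nu>}"

definition wasserstein1 :: "real measure \<Rightarrow> real measure \<Rightarrow> ennreal" where
  "wasserstein1 \<mu> \<nu> = (INF \<gamma>\<in>couplings \<mu> \<nu>. \<integral>\<^sup>+ p. ennreal \<bar>fst p - snd p\<bar> \<partial>\<gamma>)"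

end

theory Submission
  imports Defs
begin

text \<open>For random variables \<open>A\<close>, \<open>B\<close> on a common probability space, Tonelli's theorem writes the
  expectation of \<open>\<bar>A - B\<bar>\<close> as the integral over \<open>t\<close> of the probability that \<open>t\<close> separates \<open>A\<close>
  from \<open>B\<close>. That probability is at least \<open>\<bar>F t - G t\<bar>\<close> for the two distribution functions, and for
  the quantile coupling the separating events are \<open>U\<close> lying between \<open>F t\<close> and \<open>G t\<close>, so equality
  holds. Hence the quantile coupling is optimal, and the Wasserstein distance is the integral of
  \<open>\<bar>F t - G t\<bar>\<close>, which the uniform estimate bounds by \<open>\<integral> C exp (- r (b + t)) dt\<close> over \<open>t \<ge> 0\<close>.\<close>

subsection \<open>Quantile functions of nonnegative laws\<close>

locale nonneg_distribution = cdf_distribution +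
  assumes AE_nonneg: "AE x in M. 0 \<le> x"
begin

lemma cdf_neg: "cdf M t = 0" if "t < 0"
proof -
  have "AE x in M. x \<notin> {..t}"
    using AE_nonneg by eventually_elim (use that in auto)
  then show ?thesis
    by (auto simp: cdf_def prob_eq_0)
qed

text \<open>The restriction to t \<ge> 0 in \<open>quantile\<close> removes nothing: the
  distribution function of a nonnegative law vanishes on the negative axis, so no negative t reaches
  a level u > 0. Facts about the pseudoinverse \<open>I\<close> thus carry over.\<close>

lemma quantile_eq_pseudoinverse: "quantile (cdf M) u = I u" if "0 < u"
proof -
  have "{t. 0 \<le> t \<and> u \<le> cdf M t} = {t. u \<le> cdf M t}"
  proof (intro Collect_cong iffI conjI)
    fix t assume "u \<le> cdf M t"
    with that cdf_neg[of t] show "0 \<le> t"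
      by linarith
  qed auto
  then show ?thesis
    by (simp add: quantile_def)
qed

text \<open>This Galois connection turns every event about quantiles of \<open>U\<close> into an
  event about \<open>U\<close> itself; the later probability computations rest on it.\<close>

lemma quantile_le_iff: "quantile (cdf M) u \<le> t \<longleftrightarrow> u \<le> cdf M t" if "u \<in> {0<..<1}"
  using that pseudoinverse[of u t] by (simp add: quantile_eq_pseudoinverse)

text \<open>Measurability of \<open>I\<close> is known on the open unit interval only. Outside it
  the quantile is constant on u \<le> 0 and on u > 1, which leaves the single point u = 1, so a case
  distinction into measurable pieces covers the line.\<close>

lemma borel_measurable_quantile: "quantile (cdf M) \<in> borel_measurable borel"
proof -
  let ?q = "quantile (cdf M)"
  \<comment> \<open>Every t \<ge> 0 qualifies, so the infimum is over the same set as for u =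
    0.\<close>
  have low: "?q u = ?q 0" if "u \<le> 0" for u
  proof -
    have "u \<le> cdf M t" "0 \<le> cdf M t" for t
      using that cdf_nonneg[of t] by linarith+
    then show ?thesis
      by (simp add: quantile_def)
  qed
  \<comment> \<open>No t qualifies. The value is the infimum of the empty set, which need not be
    known: it is the same for all u > 1, with 2 as representative.\<close>
  have high: "?q u = ?q 2" if "1 < u" for u
  proof -
    have "\<not> u \<le> cdf M t" "\<not> 2 \<le> cdf M t" for t
      using that cdf_bounded_prob[of t] by linarith+
    then show ?thesis
      by (simp add: quantile_def)
  qed
  have "(\<lambda>u. if u \<in> {0<..<1} then I u else 0) \<in> borel_measurable borel"
  proof (subst measurable_If_restrict_space_iff)
    show "I \<in> borel_measurable (restrict_space borel {u. u \<in> {0<..<1}}) \<and>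
        (\<lambda>u. 0) \<in> borel_measurable (restrict_space borel {u. u \<notin> {0<..<1}})"
      unfolding Collect_mem_eq using measurable_CI by (intro conjI) auto
  qed auto
  then have "(\<lambda>u. if u \<le> 0 then ?q 0 else if u < 1 then (if u \<in> {0<..<1} then I u else 0)
      else if u = 1 then ?q 1 else ?q 2) \<in> borel_measurable borel"
    by measurable
  also have "(\<lambda>u. if u \<le> 0 then ?q 0 else if u < 1 then (if u \<in> {0<..<1} then I u else 0)
      else if u = 1 then ?q 1 else ?q 2) = ?q"
  proof
    fix u
    show "(if u \<le> 0 then ?q 0 else if u < 1 then (if u \<in> {0<..<1} then I u else 0)
        else if u = 1 then ?q 1 else ?q 2) = ?q u"
      using low[of u] high[of u] quantile_eq_pseudoinverse[of u] by auto
  qed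
  finally show ?thesis .
qed

end

subsection \<open>Uniform random variables\<close>

lemma emeasure_uniform01:
  fixes p q :: real
  assumes "0 \<le> p" "p \<le> q" "q \<le> 1"
  shows "emeasure (uniform_measure lborel {0<..<1}) {p<..q} = ennreal (q - p)"
proof -
  \<comment> \<open>If q = 1, the right endpoint lies outside the open unit interval, so the two
    sets agree only up to a null set.\<close>
  have int: "emeasure lborel ({0<..<1} \<inter> {p<..q}) = emeasure lborel {p<..q}"
  proof (rule emeasure_eq_AE)
    show "AE x in lborel. x \<in> {0<..<1} \<inter> {p<..q} \<longleftrightarrow> x \<in> {p<..q}"
      using AE_lborel_singleton[of 1] by eventually_elim (use assms in auto)
  qed auto
  have "emeasure (uniform_measure lborel {0<..<1}) {p<..q} = ennreal (q - p) / ennreal 1"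
    by (subst emeasure_uniform_measure) (use assms int in auto)
  also have "\<dots> = ennreal ((q - p) / 1)"
    using assms by (intro divide_ennreal) auto
  finally show ?thesis
    by simp
qed

locale uniform01_variable = prob_space N for N :: "'u measure" +
  fixes U :: "'u \<Rightarrow> real"
  assumes U_measurable [measurable]: "U \<in> borel_measurable N"
    and distr_U: "distr N borel U = uniform_measure lborel {0<..<1}"
begin

lemma AE_U: "AE \<omega> in N. U \<omega> \<in> {0<..<1}"
proof -
  have "AE u in distr N borel U. u \<in> {0<..<1}"
    unfolding distr_U by (rule AE_uniform_measureI) auto
  then show ?thesis
    by (subst (asm) AE_distr_iff) auto
qed

lemma emeasure_U_Ioc:
  assumes "0 \<le> p" "p \<le> q" "q \<le> 1"
  shows "emeasure N {\<omega> \<in> space N. p < U \<omega> \<and> U \<omega> \<le> q} = ennreal (q - p)"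
proof -
  have "emeasure N {\<omega> \<in> space N. p < U \<omega> \<and> U \<omega> \<le> q} = emeasure (distr N borel U) {p<..q}"
    by (subst emeasure_distr) (auto intro!: arg_cong[where f = "emeasure N"])
  also have "\<dots> = ennreal (q - p)"
    unfolding distr_U by (rule emeasure_uniform01) fact+
  finally show ?thesis .
qed

lemma measurable_quantile_U:
  assumes "nonneg_distribution M"
  shows "(\<lambda>\<omega>. quantile (cdf M) (U \<omega>)) \<in> borel_measurable N"
  using nonneg_distribution.borel_measurable_quantile[OF assms] by measurable

text \<open>Inverse transform sampling: almost surely the quantile is at most t exactly when
  \<open>U\<close> \<le> F t, an event of probability F t, and the distribution function determines
  the law.\<close>

lemma distr_quantile_U:
  assumes "nonneg_distribution M"
  shows "distr N borel (\<lambda>\<omega>. quantile (cdf M) (U \<omega>)) = M" (is "distr N borel ?R = M")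
proof (rule cdf_unique)
  interpret M: nonneg_distribution M
    by fact
  note [measurable] = measurable_quantile_U[OF assms]
  show "real_distribution (distr N borel ?R)"
    by simp
  show "real_distribution M"
    by unfold_locales
  show "cdf (distr N borel ?R) = cdf M"
  proof
    fix t
    have "emeasure N {\<omega> \<in> space N. ?R \<omega> \<le> t} = emeasure N {\<omega> \<in> space N. 0 < U \<omega> \<and> U \<omega> \<le> cdf M t}"
    proof (rule emeasure_eq_AE)
      show "AE \<omega> in N. \<omega> \<in> {\<omega> \<in> space N. ?R \<omega> \<le> t} \<longleftrightarrow>
          \<omega> \<in> {\<omega> \<in> space N. 0 < U \<omega> \<and> U \<omega> \<le> cdf M t}"
        using AE_U by eventually_elim (auto simp: M.quantile_le_iff)
    qed measurable
    also have "\<dots> = ennreal (cdf M t)"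
      using emeasure_U_Ioc[of 0 "cdf M t"] M.cdf_nonneg M.cdf_bounded_prob by simp
    finally have "measure N {\<omega> \<in> space N. ?R \<omega> \<le> t} = cdf M t"
      using M.cdf_nonneg by (simp add: measure_def)
    moreover have "?R -` {..t} \<inter> space N = {\<omega> \<in> space N. ?R \<omega> \<le> t}"
      by auto
    ultimately show "cdf (distr N borel ?R) t = cdf M t"
      by (subst cdf_def, subst measure_distr) auto
  qed
qed

end

subsection \<open>The Wasserstein distance on the line\<close>

lemma (in sigma_finite_measure) nn_integral_abs_diff:
  fixes A B :: "'a \<Rightarrow> real"
  assumes [measurable]: "A \<in> borel_measurable M" "B \<in> borel_measurable M"
  shows "(\<integral>\<^sup>+ \<omega>. ennreal \<bar>A \<omega> - B \<omega>\<bar> \<partial>M) =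
    (\<integral>\<^sup>+ t. emeasure M {\<omega> \<in> space M. A \<omega> \<le> t \<and> t < B \<omega> \<or> B \<omega> \<le> t \<and> t < A \<omega>} \<partial>lborel)"
proof -
  interpret pair_sigma_finite M lborel ..
  let ?S = "{p \<in> space (M \<Otimes>\<^sub>M lborel). A (fst p) \<le> snd p \<and> snd p < B (fst p) \<or>
    B (fst p) \<le> snd p \<and> snd p < A (fst p)}"
  let ?f = "\<lambda>\<omega> t. indicator ?S (\<omega>, t) :: ennreal"
  have S [measurable]: "?S \<in> sets (M \<Otimes>\<^sub>M lborel)"
    by measurable
  have "(\<integral>\<^sup>+ \<omega>. ennreal \<bar>A \<omega> - B \<omega>\<bar> \<partial>M) = (\<integral>\<^sup>+ \<omega>. (\<integral>\<^sup>+ t. ?f \<omega> t \<partial>lborel) \<partial>M)"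
  proof (rule nn_integral_cong)
    fix \<omega> assume "\<omega> \<in> space M"
    \<comment> \<open>The points that separate the two values form a half-open interval, closed on
      the left because the events have the form \<open>A \<omega> \<le> t\<close>. Its length is the
      distance of the values.\<close>
    then have "?f \<omega> t = indicator {min (A \<omega>) (B \<omega>)..<max (A \<omega>) (B \<omega>)} t" for t
      by (auto simp: indicator_def space_pair_measure)
    then have "(\<integral>\<^sup>+ t. ?f \<omega> t \<partial>lborel) = emeasure lborel {min (A \<omega>) (B \<omega>)..<max (A \<omega>) (B \<omega>)}"
      by simp
    also have "\<dots> = ennreal \<bar>A \<omega> - B \<omega>\<bar>"
      by (simp add: max_def min_def)
    finally show "ennreal \<bar>A \<omega> - B \<omega>\<bar> = (\<integral>\<^sup>+ t. ?f \<omega> t \<partial>lborel)" ..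
  qed
  also have "\<dots> = (\<integral>\<^sup>+ t. (\<integral>\<^sup>+ \<omega>. ?f \<omega> t \<partial>M) \<partial>lborel)"
    by (rule Fubini'[symmetric]) measurable
  also have "\<dots> =
    (\<integral>\<^sup>+ t. emeasure M {\<omega> \<in> space M. A \<omega> \<le> t \<and> t < B \<omega> \<or> B \<omega> \<le> t \<and> t < A \<omega>} \<partial>lborel)"
  proof (rule nn_integral_cong)
    fix t :: real
    have "(\<integral>\<^sup>+ \<omega>. ?f \<omega> t \<partial>M) = (\<integral>\<^sup>+ \<omega>. indicator
        {\<omega> \<in> space M. A \<omega> \<le> t \<and> t < B \<omega> \<or> B \<omega> \<le> t \<and> t < A \<omega>} \<omega> \<partial>M)"
      by (intro nn_integral_cong) (auto simp: indicator_def space_pair_measure)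
    then show "(\<integral>\<^sup>+ \<omega>. ?f \<omega> t \<partial>M) =
        emeasure M {\<omega> \<in> space M. A \<omega> \<le> t \<and> t < B \<omega> \<or> B \<omega> \<le> t \<and> t < A \<omega>}"
      by simp
  qed
  finally show ?thesis .
qed

lemma nn_integral_cdf_diff_le_coupling:
  assumes "\<gamma> \<in> couplings \<mu> \<nu>"
  shows "(\<integral>\<^sup>+ t. ennreal \<bar>cdf \<mu> t - cdf \<nu> t\<bar> \<partial>lborel) \<le> (\<integral>\<^sup>+ p. ennreal \<bar>fst p - snd p\<bar> \<partial>\<gamma>)"
proof -
  have sets [measurable_cong]: "sets \<gamma> = sets (borel \<Otimes>\<^sub>M borel)"
    and \<mu>: "distr \<gamma> borel fst = \<mu>" and \<nu>: "distr \<gamma> borel snd = \<nu>"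
    using assms by (auto simp: couplings_def)
  interpret prob_space \<gamma>
    using assms by (simp add: couplings_def)
  have [measurable]: "fst \<in> borel_measurable \<gamma>" "snd \<in> borel_measurable \<gamma>"
    by (simp_all cong: measurable_cong_sets add: measurable_cong_sets[OF sets refl])
  have "ennreal \<bar>cdf \<mu> t - cdf \<nu> t\<bar> \<le>
      emeasure \<gamma> {p \<in> space \<gamma>. fst p \<le> t \<and> t < snd p \<or> snd p \<le> t \<and> t < fst p}" for t
  proof -
    let ?A = "{p \<in> space \<gamma>. fst p \<le> t}" and ?B = "{p \<in> space \<gamma>. snd p \<le> t}"
    let ?D = "{p \<in> space \<gamma>. fst p \<le> t \<and> t < snd p \<or> snd p \<le> t \<and> t < fst p}"
    have "cdf \<mu> t = prob ?A"
      by (auto simp: cdf_def \<mu>[symmetric] measure_distr intro!: arg_cong[where f = prob])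
    moreover have "cdf \<nu> t = prob ?B"
      by (auto simp: cdf_def \<nu>[symmetric] measure_distr intro!: arg_cong[where f = prob])
    \<comment> \<open>\<open>?D\<close> is the symmetric difference of \<open>?A\<close> and
      \<open>?B\<close>, so each of these is covered by the other one together with
      \<open>?D\<close>.\<close>
    moreover have "prob ?A \<le> prob (?B \<union> ?D)" "prob ?B \<le> prob (?A \<union> ?D)"
      by (auto intro!: finite_measure_mono)
    moreover have "prob (?B \<union> ?D) \<le> prob ?B + prob ?D" "prob (?A \<union> ?D) \<le> prob ?A + prob ?D"
      by (auto intro!: measure_Un_le)
    ultimately have "\<bar>cdf \<mu> t - cdf \<nu> t\<bar> \<le> prob ?D"
      by linarith
    then show ?thesis
      by (simp add: emeasure_eq_measure)
  qed
  then show ?thesis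
    by (subst nn_integral_abs_diff) (auto intro!: nn_integral_mono)
qed

context uniform01_variable
begin

text \<open>Since one \<open>U\<close> drives both quantiles, the events that they are at most t are
  nested up to a null set. Their symmetric difference then has exactly the probability \<bar>F t - G
  t\<bar>, with no loss as for a general coupling.\<close>

lemma nn_integral_quantile_diff:
  assumes "nonneg_distribution \<mu>" "nonneg_distribution \<nu>"
  shows "(\<integral>\<^sup>+ \<omega>. ennreal \<bar>quantile (cdf \<mu>) (U \<omega>) - quantile (cdf \<nu>) (U \<omega>)\<bar> \<partial>N) =
    (\<integral>\<^sup>+ t. ennreal \<bar>cdf \<mu> t - cdf \<nu> t\<bar> \<partial>lborel)"
proof -
  interpret \<mu>: nonneg_distribution \<mu> by fact
  interpret \<nu>: nonneg_distribution \<nu> by fact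
  note [measurable] = assms[THEN measurable_quantile_U]
  let ?A = "\<lambda>\<omega>. quantile (cdf \<mu>) (U \<omega>)" and ?B = "\<lambda>\<omega>. quantile (cdf \<nu>) (U \<omega>)"
  have "emeasure N {\<omega> \<in> space N. ?A \<omega> \<le> t \<and> t < ?B \<omega> \<or> ?B \<omega> \<le> t \<and> t < ?A \<omega>} =
      ennreal \<bar>cdf \<mu> t - cdf \<nu> t\<bar>" for t
  proof -
    let ?p = "min (cdf \<mu> t) (cdf \<nu> t)" and ?q = "max (cdf \<mu> t) (cdf \<nu> t)"
    have "emeasure N {\<omega> \<in> space N. ?A \<omega> \<le> t \<and> t < ?B \<omega> \<or> ?B \<omega> \<le> t \<and> t < ?A \<omega>} =
        emeasure N {\<omega> \<in> space N. ?p < U \<omega> \<and> U \<omega> \<le> ?q}"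
    proof (rule emeasure_eq_AE)
      show "AE \<omega> in N. \<omega> \<in> {\<omega> \<in> space N. ?A \<omega> \<le> t \<and> t < ?B \<omega> \<or> ?B \<omega> \<le> t \<and> t < ?A \<omega>} \<longleftrightarrow>
          \<omega> \<in> {\<omega> \<in> space N. ?p < U \<omega> \<and> U \<omega> \<le> ?q}"
        using AE_U
        by eventually_elim (auto simp: \<mu>.quantile_le_iff \<nu>.quantile_le_iff not_le[symmetric])
    qed measurable
    also have "\<dots> = ennreal (?q - ?p)"
      using \<mu>.cdf_nonneg \<nu>.cdf_nonneg \<mu>.cdf_bounded_prob \<nu>.cdf_bounded_prob
      by (intro emeasure_U_Ioc) auto
    also have "?q - ?p = \<bar>cdf \<mu> t - cdf \<nu> t\<bar>"
      by linarith
    finally show ?thesis .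
  qed
  then show ?thesis
    by (subst nn_integral_abs_diff) auto
qed

lemma wasserstein1_eq_nn_integral_cdf_diff:
  assumes "nonneg_distribution \<mu>" "nonneg_distribution \<nu>"
  shows "wasserstein1 \<mu> \<nu> = (\<integral>\<^sup>+ t. ennreal \<bar>cdf \<mu> t - cdf \<nu> t\<bar> \<partial>lborel)"
proof (rule antisym)
  note [measurable] = assms[THEN measurable_quantile_U]
  let ?A = "\<lambda>\<omega>. quantile (cdf \<mu>) (U \<omega>)" and ?B = "\<lambda>\<omega>. quantile (cdf \<nu>) (U \<omega>)"
  \<comment> \<open>The joint law of the two quantiles is the coupling that attains the
    infimum.\<close>
  let ?\<gamma> = "distr N (borel \<Otimes>\<^sub>M borel) (\<lambda>\<omega>. (?A \<omega>, ?B \<omega>))"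
  have "distr ?\<gamma> borel fst = \<mu>" "distr ?\<gamma> borel snd = \<nu>"
    by (simp_all add: distr_distr comp_def distr_quantile_U assms)
  then have "?\<gamma> \<in> couplings \<mu> \<nu>"
    by (auto simp: couplings_def intro!: prob_space_distr)
  then have "wasserstein1 \<mu> \<nu> \<le> (\<integral>\<^sup>+ p. ennreal \<bar>fst p - snd p\<bar> \<partial>?\<gamma>)"
    unfolding wasserstein1_def by (rule INF_lower)
  also have "\<dots> = (\<integral>\<^sup>+ \<omega>. ennreal \<bar>?A \<omega> - ?B \<omega>\<bar> \<partial>N)"
    by (subst nn_integral_distr) auto
  finally show "wasserstein1 \<mu> \<nu> \<le> (\<integral>\<^sup>+ t. ennreal \<bar>cdf \<mu> t - cdf \<nu> t\<bar> \<partial>lborel)"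
    by (simp add: nn_integral_quantile_diff assms)
  show "(\<integral>\<^sup>+ t. ennreal \<bar>cdf \<mu> t - cdf \<nu> t\<bar> \<partial>lborel) \<le> wasserstein1 \<mu> \<nu>"
    unfolding wasserstein1_def by (intro INF_greatest nn_integral_cdf_diff_le_coupling)
qed

end

lemma nn_integral_cdf_diff_le_exp:
  assumes "nonneg_distribution \<mu>" "nonneg_distribution \<nu>" and "C > 0" "r > 0"
    and bound: "\<And>y. y > 0 \<Longrightarrow> \<bar>cdf \<mu> y - cdf \<nu> y\<bar> \<le> C * exp (- r * (b + y))"
  shows "(\<integral>\<^sup>+ t. ennreal \<bar>cdf \<mu> t - cdf \<nu> t\<bar> \<partial>lborel) \<le> ennreal (C / r * exp (- r * b))"
proof -
  have "(\<integral>\<^sup>+ t. ennreal \<bar>cdf \<mu> t - cdf \<nu> t\<bar> \<partial>lborel) \<le>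
      (\<integral>\<^sup>+ t. ennreal (C * exp (- r * (b + t))) * indicator {0..} t \<partial>lborel)"
  proof (rule nn_integral_mono_AE)
    show "AE t in lborel. ennreal \<bar>cdf \<mu> t - cdf \<nu> t\<bar> \<le>
        ennreal (C * exp (- r * (b + t))) * indicator {0..} t"
      \<comment> \<open>The estimate is given for y > 0 and both distribution functions vanish for t
        < 0; the remaining point t = 0 is null.\<close>
      using AE_lborel_singleton[of 0]
    proof eventually_elim
      case (elim t)
      then show ?case
        using bound[of t] assms(1,2)
        by (cases "t < 0") (auto simp: nonneg_distribution.cdf_neg intro!: ennreal_leI)
    qed
  qed
  also have "\<dots> = ennreal (0 - (- C / r * exp (- r * (b + 0))))"
  proof (rule nn_integral_FTC_atLeast)
    show "((\<lambda>t. - C / r * exp (- r * (b + t))) has_real_derivative C * exp (- r * (b + t))) (at t)"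
      for t
      using \<open>r > 0\<close> by (auto intro!: derivative_eq_intros)
    have "LIM t at_top. r * (b + t) :> at_top"
      using \<open>r > 0\<close>
      by (intro filterlim_tendsto_pos_mult_at_top[OF tendsto_const]
          filterlim_tendsto_add_at_top[OF tendsto_const] filterlim_ident)
    then have "((\<lambda>t. exp (- r * (b + t))) \<longlongrightarrow> 0) at_top"
      by (intro filterlim_compose[OF exp_at_bot]) (simp add: filterlim_uminus_at_bot)
    then show "((\<lambda>t. - C / r * exp (- r * (b + t))) \<longlongrightarrow> 0) at_top"
      by (rule tendsto_mult_right_zero)
  qed (use \<open>C > 0\<close> in auto)
  finally show ?thesis
    by simp
qed

subsection \<open>The overshoot\<close>

lemma overshoot_nonneg: "0 \<le> overshoot X b \<omega>"
proof (cases "\<exists>n\<ge>1. partial_sum X n \<omega> > b")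
  case True
  \<comment> \<open>A nonempty set of naturals contains its infimum, so the walk does exceed b at
    the passage time.\<close>
  then have "passage_time X b \<omega> \<in> {n. 1 \<le> n \<and> partial_sum X n \<omega> > b}"
    unfolding passage_time_def by (intro Inf_nat_def1) auto
  then show ?thesis
    by (simp add: overshoot_def)
next
  case False
  then show ?thesis
    by (simp only: overshoot_def if_False order_refl)
qed

lemma measurable_overshoot:
  assumes [measurable]: "\<And>n. n \<ge> 1 \<Longrightarrow> X n \<in> borel_measurable M"
  shows "overshoot X b \<in> borel_measurable M"
proof -
  have [measurable]: "(\<lambda>\<omega>. partial_sum X n \<omega>) \<in> borel_measurable M" for n
    unfolding partial_sum_def by (intro borel_measurable_sum) auto
  have [measurable]: "passage_time X b \<in> measurable M (count_space UNIV)"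
    unfolding passage_time_def[abs_def] Inf_nat_def by measurable
  \<comment> \<open>The random index takes countably many values, so measurability of each partial
    sum suffices.\<close>
  have "(\<lambda>\<omega>. partial_sum X (passage_time X b \<omega>) \<omega>) \<in> borel_measurable M"
    by (rule measurable_compose_countable) auto
  then show ?thesis
    unfolding overshoot_def[abs_def] by measurable
qed

lemma nonneg_distribution_overshoot_law:
  assumes "iid_with_law P X F"
  shows "nonneg_distribution (overshoot_law P X b)"
proof -
  interpret P: prob_space P
    using assms by (simp add: iid_with_law_def)
  have [measurable]: "overshoot X b \<in> borel_measurable P"
    using assms by (intro measurable_overshoot) (auto simp: iid_with_law_def P.indep_vars_def2)
  interpret real_distribution "overshoot_law P X b"
    unfolding overshoot_law_def by simp
  have "AE x in overshoot_law P X b. 0 \<le> x"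
    unfolding overshoot_law_def by (subst AE_distr_iff) (auto simp: overshoot_nonneg)
  then show ?thesis
    by unfold_locales
qed

theorem corollary3:
  fixes F0 :: "real measure" and \<theta>max :: ereal
    and P :: "real \<Rightarrow> 'w measure" and X :: "nat \<Rightarrow> 'w \<Rightarrow> real"
    and Linf :: "real \<Rightarrow> real measure"
    and C r \<theta>s \<theta> b :: real
    and N :: "'u measure" and U :: "'u \<Rightarrow> real"
  assumes "standard_exp_family F0 \<theta>max"
    and "\<forall>t\<in>param_space \<theta>max. iid_with_law (P t) X (tilted F0 t)"
    and "\<forall>t\<in>param_space \<theta>max. limit_overshoot_law (P t) X (Linf t)"
    and "C > 0" and "r > 0" and "\<theta>s > 0" and "{0..\<theta>s} \<subseteq> param_space \<theta>max"
    and "\<forall>c>0. \<forall>y>0.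
           (SUP t\<in>{0..\<theta>s}. \<bar>cdf (overshoot_law (P t) X c) y - cdf (Linf t) y\<bar>)
             \<le> C * exp (- r * (c + y))"
    and "\<theta> \<in> {0..\<theta>s}" and "b > 0"
    and "prob_space N" and "U \<in> borel_measurable N"
    and "distr N borel U = uniform_measure lborel {0<..<1}"
  shows "let Fb = cdf (overshoot_law (P \<theta>) X b); Finf = cdf (Linf \<theta>);
             Rb = (\<lambda>\<omega>. quantile Fb (U \<omega>)); Rinf = (\<lambda>\<omega>. quantile Finf (U \<omega>))
         in distr N borel Rb = overshoot_law (P \<theta>) X b \<and>
            distr N borel Rinf = Linf \<theta> \<and>
            (\<integral>\<^sup>+ \<omega>. ennreal \<bar>Rb \<omega> - Rinf \<omega>\<bar> \<partial>N) = wasserstein1 (overshoot_law (P \<theta>) X b) (Linf \<theta>) \<and>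
            wasserstein1 (overshoot_law (P \<theta>) X b) (Linf \<theta>) \<le> ennreal (C / r * exp (- r * b))"
proof -
  have iid: "iid_with_law (P t) X (tilted F0 t)" and lim: "limit_overshoot_law (P t) X (Linf t)"
    if "t \<in> {0..\<theta>s}" for t
    using assms(2,3,7) that by auto
  \<comment> \<open>This and the next fact cover the whole parameter interval, not just \<theta>,
    because the supremum in the estimate ranges over it.\<close>
  have ov: "nonneg_distribution (overshoot_law (P t) X c)" if "t \<in> {0..\<theta>s}" for t c
    using iid[OF that] by (rule nonneg_distribution_overshoot_law)
  have li: "nonneg_distribution (Linf t)" if "t \<in> {0..\<theta>s}" for t
    using lim[OF that]
    by (auto simp: limit_overshoot_law_def nonneg_distribution_def cdf_distribution_def
        nonneg_distribution_axioms_def)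
  interpret uniform01_variable N U
    using assms(11-13) by (simp add: uniform01_variable_def uniform01_variable_axioms_def)
  have "\<bar>cdf (overshoot_law (P \<theta>) X b) y - cdf (Linf \<theta>) y\<bar> \<le> C * exp (- r * (b + y))"
    if "y > 0" for y
  proof -
    let ?d = "\<lambda>t. \<bar>cdf (overshoot_law (P t) X b) y - cdf (Linf t) y\<bar>"
    \<comment> \<open>A real supremum dominates its members only if the family is bounded above.
      Here 1 is a bound, as all values of distribution functions lie between 0 and 1.\<close>
    have "bdd_above (?d ` {0..\<theta>s})"
    proof (rule bdd_aboveI2)
      fix t assume t: "t \<in> {0..\<theta>s}"
      interpret A: nonneg_distribution "overshoot_law (P t) X b" by (rule ov[OF t])
      interpret B: nonneg_distribution "Linf t" by (rule li[OF t])
      show "?d t \<le> 1"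
        using A.cdf_nonneg[of y] A.cdf_bounded_prob[of y] B.cdf_nonneg[of y] B.cdf_bounded_prob[of y]
        by linarith
    qed
    then have "?d \<theta> \<le> (SUP t\<in>{0..\<theta>s}. ?d t)"
      using assms(9) by (intro cSUP_upper)
    also have "\<dots> \<le> C * exp (- r * (b + y))"
      using assms(8,10) that by blast
    finally show ?thesis .
  qed
  then have "(\<integral>\<^sup>+ t. ennreal \<bar>cdf (overshoot_law (P \<theta>) X b) t - cdf (Linf \<theta>) t\<bar> \<partial>lborel)
      \<le> ennreal (C / r * exp (- r * b))"
    using ov[OF assms(9)] li[OF assms(9)] assms(4,5) by (intro nn_integral_cdf_diff_le_exp)
  then show ?thesis
    using ov[OF assms(9)] li[OF assms(9)]
    by (simp add: Let_def distr_quantile_U nn_integral_quantile_diff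
        wasserstein1_eq_nn_integral_cdf_diff)
qed

end
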